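(* Let $\mathcal{G}=(H,\sigma,\alpha,h_0)$ be a rooted combinatorial map with underlying graph $G=(V,E)$. For each spanning tree $T$ of $G$, let $[T^-,T^+]$ denote the set of edge subsets $S\subseteq E$ obtained from $T$ by removing some (possibly none) internal $(\mathcal{G},T)$-active edges and adding some (possibly none) external $(\mathcal{G},T)$-active edges. Then the sets $[T^-,T^+]$, as $T$ ranges over the spanning trees of $G$, are pairwise disjoint and their union is the set $2^E$ of all subsets of $E$: $$2^E=\biguplus_{T\text{ spanning tree}}[T^-,T^+].$$
   Context: A rooted combinatorial map is $\mathcal{G}=(H,\sigma,\alpha,h_0)$ where $H$ is a finite set of half-edges, $\sigma$ is a permutation of $H$, $\alpha$ is a fixed-point-free involution of $H$, the group generated by $\sigma,\alpha$ acts transitively on $H$, and $h_0\in H$ is the root. Its underlying graph $G=(V,E)$ has the cycles of $\sigma$ as vertices and the pairs $\{h,\alpha(h)\}$ as edges; a half-edge is incident to the vertex (cycle of $\sigma$) containing it, and the endpoints of an edge are the vertices incident to its two half-edges ($G$ is connected; loops and multiple edges allowed). Subgraphs are spanning and identified with their edge sets. For a spanning tree $T$, edges in $T$ are internal, the others external. The motion function is $t(h)=\sigma\alpha(h)$ if the edge containing $h$ is internal and $t(h)=\sigma(h)$ otherwise; it is a cyclic permutation of $H$. The $(\mathcal{G},T)$-order on $H$ is $h_0<t(h_0)<t^2(h_0)<\dots<t^{|H|-1}(h_0)$, and edges are ordered by $\{h_1,h_2\}<\{h_1',h_2'\}$ iff $\min(h_1,h_2)<\min(h_1',h_2')$. The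 fundamental cycle of an external edge $e$ is the set of edges $e'$ such that $T-e'+e$ is a spanning tree; the fundamental cocycle of an internal edge $e$ is the set of edges $e'$ such that $T-e+e'$ is a spanning tree. An external (resp. internal) edge is $(\mathcal{G},T)$-active if it is minimal for the $(\mathcal{G},T)$-order in its fundamental cycle (resp. cocycle). *)

theory Defs
  imports
    "HOL-Algebra.Generated_Groups"
    "HOL-Combinatorics.Orbits"
    "HOL-Library.Disjoint_Sets"
begin

definition perm_group :: "'h set \<Rightarrow> ('h \<Rightarrow> 'h) monoid" where
  "perm_group H = \<lparr>carrier = {p. p permutes H}, monoid.mult = (\<circ>), one = id\<rparr>"

lemma group_perm_group: "group (perm_group H)"
proof (rule groupI)
  fix p assume "p \<in> carrier (perm_group H)"
  then show "\<exists>q\<in>carrier (perm_group H). q \<otimes>\<^bsub>perm_group H\<^esub> p = \<one>\<^bsub>perm_group H\<^esub>"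
    by (auto simp: perm_group_def intro!: bexI[of _ "inv_into UNIV p"] permutes_inv
        dest: permutes_inv_o)
qed (auto simp: perm_group_def permutes_compose permutes_id comp_assoc)

locale rooted_map =
  fixes H :: "'h set" and \<sigma> :: "'h \<Rightarrow> 'h" and \<alpha> :: "'h \<Rightarrow> 'h" and h\<^sub>0 :: 'h
  assumes finite_H: "finite H"
    and sigma_permutes: "\<sigma> permutes H"
    and alpha_permutes: "\<alpha> permutes H"
    and alpha_involution: "\<And>h. h \<in> H \<Longrightarrow> \<alpha> (\<alpha> h) = h"
    and alpha_no_fixpoint: "\<And>h. h \<in> H \<Longrightarrow> \<alpha> h \<noteq> h"
    and transitive:
      "\<And>h h'. \<lbrakk>h \<in> H; h' \<in> H\<rbrakk> \<Longrightarrow> \<exists>g\<in>generate (perm_group H) {\<sigma>, \<alpha>}. g h = h'"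
    and root_in_H: "h\<^sub>0 \<in> H"
begin

definition vertex_of :: "'h \<Rightarrow> 'h set" where
  "vertex_of h = orbit \<sigma> h"

definition edge_of :: "'h \<Rightarrow> 'h set" where
  "edge_of h = {h, \<alpha> h}"

definition verts :: "'h set set" where
  "verts = vertex_of ` H"

definition edges :: "'h set set" where
  "edges = edge_of ` H"

text \<open>Spanning subgraphs are identified with their edge sets \<open>S \<subseteq> edges\<close>.\<close>

definition adjacency :: "'h set set \<Rightarrow> ('h set \<times> 'h set) set" where
  "adjacency S = {(vertex_of h, vertex_of (\<alpha> h)) | h. h \<in> H \<and> edge_of h \<in> S}"

definition connected_subgraph :: "'h set set \<Rightarrow> bool" where
  "connected_subgraph S \<longleftrightarrow> (\<forall>u\<in>verts. \<forall>v\<in>verts. (u, v) \<in> (adjacency S)\<^sup>*)"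

text \<open>
  A simple closed path is given by the list of half-edges along which it leaves its successive
  vertices. Requiring distinct edges excludes going back and forth along one edge, while loops
  (length 1) and pairs of parallel edges (length 2) are cycles.
\<close>

definition simple_cycle :: "'h set set \<Rightarrow> 'h list \<Rightarrow> bool" where
  "simple_cycle S hs \<longleftrightarrow>
     hs \<noteq> [] \<and> set hs \<subseteq> H \<and> edge_of ` set hs \<subseteq> S \<and>
     distinct (map vertex_of hs) \<and> distinct (map edge_of hs) \<and>
     (\<forall>i<length hs. vertex_of (\<alpha> (hs ! i)) = vertex_of (hs ! (Suc i mod length hs)))"

definition spanning_tree :: "'h set set \<Rightarrow> bool" where
  "spanning_tree T \<longleftrightarrow> T \<subseteq> edges \<and> connected_subgraph T \<and> (\<nexists>hs. simple_cycle T hs)"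

definition motion :: "'h set set \<Rightarrow> 'h \<Rightarrow> 'h" where
  "motion T h = (if edge_of h \<in> T then \<sigma> (\<alpha> h) else \<sigma> h)"

text \<open>
  The order \<open>h\<^sub>0 < t h\<^sub>0 < t\<^sup>2 h\<^sub>0 < \<dots>\<close> on half-edges is the order of their positions,
  where \<open>t = motion T\<close>.
\<close>

definition position :: "'h set set \<Rightarrow> 'h \<Rightarrow> nat" where
  "position T h = (LEAST n. (motion T ^^ n) h\<^sub>0 = h)"

definition edge_less :: "'h set set \<Rightarrow> 'h set \<Rightarrow> 'h set \<Rightarrow> bool" where
  "edge_less T e e' \<longleftrightarrow> Min (position T ` e) < Min (position T ` e')"

text \<open>
  Both sets below contain \<open>e\<close> itself; for the cycle this requires adding \<open>e\<close> before removing \<open>e'\<close>.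
\<close>

definition fundamental_cycle :: "'h set set \<Rightarrow> 'h set \<Rightarrow> 'h set set" where
  "fundamental_cycle T e = {e' \<in> edges. spanning_tree (insert e T - {e'})}"

definition fundamental_cocycle :: "'h set set \<Rightarrow> 'h set \<Rightarrow> 'h set set" where
  "fundamental_cocycle T e = {e' \<in> edges. spanning_tree (insert e' (T - {e}))}"

definition external_active :: "'h set set \<Rightarrow> 'h set set" where
  "external_active T = {e \<in> edges - T. \<forall>e'\<in>fundamental_cycle T e. \<not> edge_less T e' e}"

definition internal_active :: "'h set set \<Rightarrow> 'h set set" where
  "internal_active T = {e \<in> T. \<forall>e'\<in>fundamental_cocycle T e. \<not> edge_less T e' e}"

definition tree_interval :: "'h set set \<Rightarrow> 'h set set set" where
  "tree_interval T = {(T - A) \<union> B | A B. A \<subseteq> internal_active T \<and> B \<subseteq> external_active T}"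

end

end

theory Submission
  imports Defs
begin

text \<open>
  Run the tour of a spanning tree \<open>T\<close> backwards from the root. Which edge is met next depends only
  on the types (internal or external) of the edges met before, so the reverse tours of all spanning
  trees form one decision tree. If an internal edge \<open>f\<close> can be exchanged for an external edge \<open>e\<close>,
  their half-edges interlace along the tour; hence comparing \<open>e\<close> and \<open>f\<close> by their first or by their
  last half-edges is the same, and an edge is active iff on the reverse tour it is met last in its
  fundamental cycle or cocycle. With \<open>P\<close> the set of edges met before \<open>e\<close>, this says that an internal
  \<open>e\<close> is active iff it is an isthmus of the graph without \<open>P - T\<close>, and an external \<open>e\<close> is active iff
  it closes a cycle with \<open>P \<inter> T\<close>: activity also depends on the past only. Two trees whose intervals
  share \<open>S\<close> therefore cannot disagree at a first edge. Conversely, a tree whose interval contains \<open>S\<close>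
  is found by following the reverse tour and, whenever an inactive edge has the type that disagrees
  with \<open>S\<close>, exchanging it for an edge not met yet.
\<close>

context rooted_map
begin

section \<open>Connectivity of spanning subgraphs\<close>

lemma sigma_in_H: "h \<in> H \<Longrightarrow> \<sigma> h \<in> H"
  using permutes_in_image[OF sigma_permutes] by blast

lemma alpha_in_H: "h \<in> H \<Longrightarrow> \<alpha> h \<in> H"
  using permutes_in_image[OF alpha_permutes] by blast

lemma edge_of_alpha: "h \<in> H \<Longrightarrow> edge_of (\<alpha> h) = edge_of h"
  by (auto simp: edge_of_def alpha_involution)

lemma edge_of_eq_iff: "h \<in> H \<Longrightarrow> edge_of g = edge_of h \<longleftrightarrow> g = h \<or> g = \<alpha> h"
  by (auto simp: edge_of_def alpha_involution doubleton_eq_iff)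

lemma edge_in_edges: "h \<in> H \<Longrightarrow> edge_of h \<in> edges"
  by (simp add: edges_def)

lemma edgesE:
  assumes "e \<in> edges" obtains h where "h \<in> H" "e = edge_of h"
  using assms by (auto simp: edges_def)

lemma finite_edges: "finite edges"
  by (simp add: edges_def finite_H)

lemma permutation_sigma: "permutation \<sigma>"
  using finite_H sigma_permutes by (auto simp: permutation_permutes)

lemma vertex_of_sigma: "vertex_of (\<sigma> h) = vertex_of h"
  by (simp add: vertex_of_def permutation_orbit_step permutation_sigma)

text \<open>Connectivity is transferred from vertices to half-edges, on which \<sigma>, \<alpha> and
  the motion function act.\<close>

definition conn :: "'h set set \<Rightarrow> 'h \<Rightarrow> 'h \<Rightarrow> bool" where
  "conn S h h' \<longleftrightarrow> (vertex_of h, vertex_of h') \<in> (adjacency S)\<^sup>*"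

lemma conn_refl: "conn S h h"
  by (simp add: conn_def)

lemma conn_trans: "conn S h h' \<Longrightarrow> conn S h' h'' \<Longrightarrow> conn S h h''"
  unfolding conn_def by (rule rtrancl_trans)

lemma sym_adjacency: "sym (adjacency S)"
  unfolding adjacency_def
  using alpha_in_H alpha_involution edge_of_alpha by (fastforce intro: symI)

lemma conn_sym: "conn S h h' \<Longrightarrow> conn S h' h"
  unfolding conn_def using sym_rtrancl[OF sym_adjacency] by (rule symD)

lemma conn_sigma: "conn S h (\<sigma> h)"
  by (simp add: conn_def vertex_of_sigma)

lemma conn_alpha: "h \<in> H \<Longrightarrow> edge_of h \<in> S \<Longrightarrow> conn S h (\<alpha> h)"
  unfolding conn_def adjacency_def by (rule r_into_rtrancl) blast

lemma conn_mono: "conn S h h' \<Longrightarrow> S \<subseteq> S' \<Longrightarrow> conn S' h h'"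
  unfolding conn_def by (erule rev_subsetD, rule rtrancl_mono) (auto simp: adjacency_def)

lemma same_vertex_closed:
  assumes "vertex_of h = vertex_of h'" "h \<in> Q" "\<And>x. x \<in> Q \<Longrightarrow> \<sigma> x \<in> Q"
  shows "h' \<in> Q"
proof -
  have "h' \<in> orbit \<sigma> h"
    using assms(1) permutation_self_in_orbit[OF permutation_sigma, of h']
    by (simp add: vertex_of_def)
  then show ?thesis
    by induction (use assms in auto)
qed

text \<open>Serves as an induction principle for \<open>conn\<close>: reachability is proved by
  exhibiting a closed set \<open>Q\<close>, without any surgery on paths.\<close>

lemma conn_closed:
  assumes "conn S h h'" "h \<in> Q"
    and "\<And>x. x \<in> Q \<Longrightarrow> \<sigma> x \<in> Q"
    and "\<And>x. x \<in> Q \<Longrightarrow> x \<in> H \<Longrightarrow> edge_of x \<in> S \<Longrightarrow> \<alpha> x \<in> Q"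
  shows "h' \<in> Q"
proof -
  \<comment> \<open>Paths only see vertices, so the claim covers all half-edges at the vertex
    reached.\<close>
  have "\<forall>x. vertex_of x = v \<longrightarrow> x \<in> Q" if "(vertex_of h, v) \<in> (adjacency S)\<^sup>*" for v
    using that
  proof induction
    case base
    then show ?case using same_vertex_closed assms(2,3) by metis
  next
    case (step u v)
    then obtain g where g: "u = vertex_of g" "v = vertex_of (\<alpha> g)" "g \<in> H" "edge_of g \<in> S"
      by (auto simp: adjacency_def)
    then have "\<alpha> g \<in> Q" using step.IH assms(4) by blast
    then show ?case using same_vertex_closed assms(3) g(2) by metis
  qed
  then show ?thesis using assms(1) by (auto simp: conn_def)
qed

lemma connected_subgraph_iff: "connected_subgraph S \<longleftrightarrow> (\<forall>h\<in>H. \<forall>h'\<in>H. conn S h h')"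
  by (auto simp: connected_subgraph_def conn_def verts_def)

lemma connected_subgraph_mono:
  "connected_subgraph S \<Longrightarrow> S \<subseteq> S' \<Longrightarrow> connected_subgraph S'"
  using conn_mono unfolding connected_subgraph_iff by blast

lemma connected_subgraph_conn:
  "connected_subgraph S \<Longrightarrow> h \<in> H \<Longrightarrow> h' \<in> H \<Longrightarrow> conn S h h'"
  by (simp add: connected_subgraph_iff)

text \<open>A path needs the added edge at most once, in one of two directions. The half-edges
  reached in this way form a closed set, since crossing \<open>g\<close> again leads back to a case
  already listed.\<close>

lemma conn_insert:
  assumes "g \<in> H" "conn (insert (edge_of g) S) h h'"
  shows "conn S h h' \<or> conn S h g \<and> conn S (\<alpha> g) h' \<or> conn S h (\<alpha> g) \<and> conn S g h'"
proof -
  let ?Q = "{x. conn S h x \<or> conn S h g \<and> conn S (\<alpha> g) x \<or> conn S h (\<alpha> g) \<and> conn S g x}"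
  have "h' \<in> ?Q"
  proof (rule conn_closed[OF assms(2)])
    fix x assume "x \<in> ?Q"
    then show "\<sigma> x \<in> ?Q" using conn_sigma conn_trans by blast
  next
    fix x assume x: "x \<in> ?Q" "x \<in> H" "edge_of x \<in> insert (edge_of g) S"
    show "\<alpha> x \<in> ?Q"
    proof (cases "edge_of x \<in> S")
      case True
      then show ?thesis using conn_alpha[OF x(2)] x(1) conn_trans by blast
    next
      case False
      then have "x = g \<or> x = \<alpha> g" using x(3) edge_of_eq_iff[OF assms(1)] by auto
      then show ?thesis
        using x(1) alpha_involution[OF assms(1)] conn_refl[of S] by auto
    qed
  qed (simp add: conn_refl)
  then show ?thesis by simp
qed

text \<open>Transitivity of the group becomes connectivity: every generator moves a half-edge within
  its component, and this passes to inverses because \<open>conn\<close> is symmetric and to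
  products because it is transitive.\<close>

lemma connected_subgraph_edges: "connected_subgraph edges"
proof -
  \<comment> \<open>\<open>generate\<close> also contains the inverses of the generators, taken in
    \<open>perm_group H\<close>; such an inverse sends \<open>h\<close> to a half-edge that
    \<open>p\<close> moves back to \<open>h\<close>.\<close>
  have inv_conn: "conn edges h ((inv\<^bsub>perm_group H\<^esub> p) h) \<and> (inv\<^bsub>perm_group H\<^esub> p) h \<in> H"
    if p: "p permutes H" "h \<in> H" and conn: "\<And>x. x \<in> H \<Longrightarrow> conn edges x (p x)" for p h
  proof -
    interpret G: group "perm_group H" by (rule group_perm_group)
    have "p \<in> carrier (perm_group H)" using p(1) by (simp add: perm_group_def)
    from G.inv_closed[OF this] G.r_inv[OF this]
    have "inv\<^bsub>perm_group H\<^esub> p permutes H" "p \<circ> inv\<^bsub>perm_group H\<^esub> p = id"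
      by (simp_all add: perm_group_def)
    then have "(inv\<^bsub>perm_group H\<^esub> p) h \<in> H" "p ((inv\<^bsub>perm_group H\<^esub> p) h) = h"
      using p(2) permutes_in_image by (metis, metis comp_apply id_apply)
    then show ?thesis using conn conn_sym by metis
  qed
  have conn: "conn edges x (\<sigma> x)" "conn edges x (\<alpha> x)" if "x \<in> H" for x
    using that by (simp_all add: conn_sigma conn_alpha edge_in_edges)
  have "\<forall>h\<in>H. conn edges h (g h) \<and> g h \<in> H" if "g \<in> generate (perm_group H) {\<sigma>, \<alpha>}" for g
    using that
  proof induction
    case one
    then show ?case by (simp add: perm_group_def conn_refl)
  next
    case (incl p)
    then show ?case using conn sigma_in_H alpha_in_H by auto
  next
    case (inv p)
    then show ?case using conn sigma_permutes alpha_permutes inv_conn by blast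
  next
    case (eng p q)
    have "p \<otimes>\<^bsub>perm_group H\<^esub> q = p \<circ> q" by (simp add: perm_group_def)
    then show ?case using eng.IH conn_trans[of edges] by (metis comp_apply)
  qed
  then show ?thesis unfolding connected_subgraph_iff using transitive by (metis (no_types))
qed

section \<open>Spanning trees\<close>

text \<open>Acyclicity, encoded as every edge being an isthmus; this form combines directly with
  \<open>conn_insert\<close>.\<close>

definition forest :: "'h set set \<Rightarrow> bool" where
  "forest F \<longleftrightarrow> (\<forall>h\<in>H. edge_of h \<in> F \<longrightarrow> \<not> conn (F - {edge_of h}) h (\<alpha> h))"

lemma forestD: "forest F \<Longrightarrow> h \<in> H \<Longrightarrow> edge_of h \<in> F \<Longrightarrow> \<not> conn (F - {edge_of h}) h (\<alpha> h)"
  by (simp add: forest_def)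

lemma forest_subset: "forest F \<Longrightarrow> F' \<subseteq> F \<Longrightarrow> forest F'"
  unfolding forest_def using conn_mono[OF _ Diff_mono[OF _ subset_refl]] by blast

section \<open>Simple walks and simple cycles\<close>

fun walk :: "'h set set \<Rightarrow> 'h set \<Rightarrow> 'h list \<Rightarrow> 'h set \<Rightarrow> bool" where
  "walk S u [] v \<longleftrightarrow> u = v"
| "walk S u (g # gs) v \<longleftrightarrow>
     g \<in> H \<and> edge_of g \<in> S \<and> vertex_of g = u \<and> walk S (vertex_of (\<alpha> g)) gs v"

lemma walk_append: "walk S u (gs @ gs') v \<longleftrightarrow> (\<exists>w. walk S u gs w \<and> walk S w gs' v)"
  by (induction gs arbitrary: u) auto

lemma walk_subset: "walk S u gs v \<Longrightarrow> set gs \<subseteq> H \<and> edge_of ` set gs \<subseteq> S"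
  by (induction gs arbitrary: u) auto

lemma walk_nth:
  "walk S u gs v \<Longrightarrow> i < length gs \<Longrightarrow>
   vertex_of (\<alpha> (gs ! i)) = (if Suc i < length gs then vertex_of (gs ! Suc i) else v)"
proof (induction gs arbitrary: u i)
  case (Cons g gs)
  then show ?case by (cases i; cases gs) auto
qed simp

text \<open>The walk grows at its front. If the new start already occurs on it, everything before
  that occurrence is dropped.\<close>

lemma simple_walk_exists:
  assumes "(u, v) \<in> (adjacency S)\<^sup>*"
  shows "\<exists>gs. walk S u gs v \<and> distinct (map vertex_of gs) \<and> v \<notin> vertex_of ` set gs"
  using assms
proof (induction rule: converse_rtrancl_induct)
  case base
  then show ?case by (auto intro: exI[of _ "[]"])
next
  case (step u w)
  then obtain gs where gs: "walk S w gs v" "distinct (map vertex_of gs)" "v \<notin> vertex_of ` set gs"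
    by blast
  obtain g where g: "u = vertex_of g" "w = vertex_of (\<alpha> g)" "g \<in> H" "edge_of g \<in> S"
    using step.hyps(1) by (auto simp: adjacency_def)
  consider "u = v" | "u \<in> vertex_of ` set gs" | "u \<noteq> v" "u \<notin> vertex_of ` set gs" by blast
  then show ?case
  proof cases
    case 1
    then show ?thesis by (auto intro: exI[of _ "[]"])
  next
    case 2
    then obtain x xs ys where x: "gs = xs @ x # ys" "u = vertex_of x"
      by (metis imageE split_list)
    then have "walk S u (x # ys) v" using gs(1) by (auto simp: walk_append)
    then show ?thesis using gs(2,3) x by (intro exI[of _ "x # ys"]) auto
  next
    case 3
    then show ?thesis using gs g by (intro exI[of _ "g # gs"]) auto
  qed
qed

text \<open>Using an edge twice would mean using it in both directions, and since the departure
  vertices are distinct, each of the two passages would have to come directly after the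
  other.\<close>

lemma simple_walk_distinct_edges:
  assumes "walk S u gs v" "distinct (map vertex_of gs)" "v \<notin> vertex_of ` set gs"
  shows "distinct (map edge_of gs)"
proof -
  have *: "j = Suc i"
    if "i < length gs" "j < length gs" "gs ! j = \<alpha> (gs ! i)" for i j
  proof -
    have eq: "vertex_of (gs ! j) = (if Suc i < length gs then vertex_of (gs ! Suc i) else v)"
      using walk_nth[OF assms(1) that(1)] that(3) by simp
    have "Suc i < length gs" using eq that(2) assms(3) by (auto split: if_splits)
    then show ?thesis using eq that(2) assms(2) by (simp add: distinct_conv_nth) metis
  qed
  have "edge_of (gs ! i) \<noteq> edge_of (gs ! j)"
    if ij: "i < length gs" "j < length gs" "i \<noteq> j" for i j
  proof
    assume eq: "edge_of (gs ! i) = edge_of (gs ! j)"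
    have H: "gs ! i \<in> H" "gs ! j \<in> H" using ij walk_subset[OF assms(1)] nth_mem by blast+
    have "gs ! i \<noteq> gs ! j" using assms(2) ij by (metis distinct_map nth_eq_iff_index_eq)
    then have "gs ! i = \<alpha> (gs ! j)" using eq edge_of_eq_iff H by blast
    moreover from this have "gs ! j = \<alpha> (gs ! i)" using alpha_involution H by simp
    ultimately have "i = Suc j" "j = Suc i" using * ij by blast+
    then show False by simp
  qed
  then show ?thesis by (simp add: distinct_conv_nth)
qed

text \<open>The edge of \<open>h\<close> closes up a simple walk that avoids it and runs from its
  far end back to \<open>h\<close>.\<close>

lemma simple_cycle_of_conn:
  assumes "h \<in> H" "edge_of h \<in> S" "conn (S - {edge_of h}) h (\<alpha> h)"
  shows "\<exists>hs. simple_cycle S hs"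
proof -
  have "(vertex_of (\<alpha> h), vertex_of h) \<in> (adjacency (S - {edge_of h}))\<^sup>*"
    using conn_sym[OF assms(3)] by (simp add: conn_def)
  then obtain gs where gs: "walk (S - {edge_of h}) (vertex_of (\<alpha> h)) gs (vertex_of h)"
      "distinct (map vertex_of gs)" "vertex_of h \<notin> vertex_of ` set gs"
    using simple_walk_exists by blast
  have sub: "set gs \<subseteq> H" "edge_of ` set gs \<subseteq> S - {edge_of h}" using walk_subset[OF gs(1)] by auto
  \<comment> \<open>Index 0 leads into the walk, or back to \<open>h\<close> if \<open>gs\<close> is
    empty; the last index returns to \<open>h\<close> through the modulus.\<close>
  have step: "vertex_of (\<alpha> ((h # gs) ! i)) = vertex_of ((h # gs) ! (Suc i mod length (h # gs)))"
    if i: "i < length (h # gs)" for i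
  proof (cases i)
    case 0
    then show ?thesis using gs(1) by (cases gs) auto
  next
    case (Suc j)
    then have j: "j < length gs" using i by simp
    then have "Suc j = length gs \<or> Suc j < length gs" by auto
    then show ?thesis
    proof
      assume len: "Suc j = length gs"
      show ?thesis using walk_nth[OF gs(1) j] by (simp add: Suc flip: len)
    next
      assume "Suc j < length gs"
      then show ?thesis using walk_nth[OF gs(1) j] by (simp add: Suc)
    qed
  qed
  have "simple_cycle S (h # gs)"
    unfolding simple_cycle_def
  proof (intro conjI)
    show "\<forall>i<length (h # gs).
        vertex_of (\<alpha> ((h # gs) ! i)) = vertex_of ((h # gs) ! (Suc i mod length (h # gs)))"
      using step by blast
    show "distinct (map edge_of (h # gs))"
      using sub(2) simple_walk_distinct_edges[OF gs] by auto
  qed (use sub gs(2,3) assms(1,2) in auto)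
  then show ?thesis by blast
qed

text \<open>Without its first edge, the cycle still leads from one end of that edge to the
  other.\<close>

lemma conn_of_simple_cycle:
  assumes "simple_cycle S hs"
  shows "\<exists>h\<in>H. edge_of h \<in> S \<and> conn (S - {edge_of h}) h (\<alpha> h)"
proof -
  let ?m = "length hs" and ?h = "hs ! 0"
  let ?S = "S - {edge_of ?h}"
  have m: "?m > 0" and sub: "set hs \<subseteq> H" "edge_of ` set hs \<subseteq> S"
    and dist: "distinct (map edge_of hs)"
    and next_vertex: "\<And>i. i < ?m \<Longrightarrow> vertex_of (\<alpha> (hs ! i)) = vertex_of (hs ! (Suc i mod ?m))"
    using assms by (auto simp: simple_cycle_def)
  have "conn ?S (\<alpha> ?h) (\<alpha> (hs ! i))" if "i < ?m" for i
    using that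
  proof (induction i)
    case 0
    then show ?case by (simp add: conn_refl)
  next
    case (Suc i)
    have eq: "vertex_of (\<alpha> (hs ! i)) = vertex_of (hs ! Suc i)"
      using next_vertex[of i] Suc.prems by simp
    have "edge_of (hs ! Suc i) \<noteq> edge_of ?h"
      using dist Suc.prems m nth_eq_iff_index_eq[OF dist, of "Suc i" 0] by simp
    then have "conn ?S (hs ! Suc i) (\<alpha> (hs ! Suc i))"
      using subsetD[OF sub(1) nth_mem[OF Suc.prems]] subsetD[OF sub(2) imageI[OF nth_mem[OF Suc.prems]]]
      by (simp add: conn_alpha)
    then show ?case using Suc eq by (auto simp: conn_def)
  qed
  from this[of "?m - 1"] have "conn ?S (\<alpha> ?h) ?h"
    using next_vertex[of "?m - 1"] m by (simp add: conn_def)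
  then show ?thesis using conn_sym sub m nth_mem[OF m] by blast
qed

lemma spanning_tree_iff:
  "spanning_tree T \<longleftrightarrow> T \<subseteq> edges \<and> connected_subgraph T \<and> forest T"
proof -
  have "(\<exists>hs. simple_cycle T hs) \<longleftrightarrow> \<not> forest T"
  proof
    assume "\<exists>hs. simple_cycle T hs"
    then show "\<not> forest T" using conn_of_simple_cycle forestD by blast
  next
    assume "\<not> forest T"
    then show "\<exists>hs. simple_cycle T hs" using simple_cycle_of_conn unfolding forest_def by blast
  qed
  then show ?thesis by (simp add: spanning_tree_def)
qed

lemma connected_subgraph_Diff:
  assumes "connected_subgraph T" "g \<in> H" "conn (T - {edge_of g}) g (\<alpha> g)"
  shows "connected_subgraph (T - {edge_of g})"
  unfolding connected_subgraph_iff
proof (intro ballI)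
  fix h h' assume "h \<in> H" "h' \<in> H"
  then have "conn (insert (edge_of g) (T - {edge_of g})) h h'"
    using assms(1) conn_mono connected_subgraph_conn by (metis insert_Diff_single subset_insertI)
  from conn_insert[OF assms(2) this] show "conn (T - {edge_of g}) h h'"
    using assms(3) conn_trans conn_sym by metis
qed

text \<open>In a connected \<open>T\<close>, an edge is an isthmus exactly if deleting it
  disconnects \<open>T\<close>. Minimality among connected sets gives existence by finiteness and is
  convenient to check after an exchange.\<close>

lemma spanning_tree_iff_minimal:
  "spanning_tree T \<longleftrightarrow>
     T \<subseteq> edges \<and> connected_subgraph T \<and> (\<forall>e\<in>T. \<not> connected_subgraph (T - {e}))"
proof -
  have "conn (T - {edge_of h}) h (\<alpha> h) \<longleftrightarrow> connected_subgraph (T - {edge_of h})"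
    if "connected_subgraph T" "h \<in> H" for h
    using connected_subgraph_Diff[OF that] connected_subgraph_conn that(2) alpha_in_H by blast
  then show ?thesis
    unfolding spanning_tree_iff forest_def by (metis edgesE subsetD)
qed

lemma spanning_tree_exists: "\<exists>T. spanning_tree T"
proof -
  let ?C = "{S. S \<subseteq> edges \<and> connected_subgraph S}"
  have "finite ?C" "?C \<noteq> {}" using finite_edges connected_subgraph_edges by auto
  from finite_has_minimal[OF this] obtain T where T: "T \<in> ?C" "\<forall>S\<in>?C. S \<subseteq> T \<longrightarrow> T = S"
    by metis
  have "\<not> connected_subgraph (T - {e})" if "e \<in> T" for e
  proof
    assume "connected_subgraph (T - {e})"
    then have "T - {e} \<in> ?C" using T(1) by auto
    then have "T = T - {e}" using T(2) by blast
    then show False using that by blast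
  qed
  then show ?thesis using T(1) unfolding spanning_tree_iff_minimal by auto
qed

section \<open>Exchanging edges of a spanning tree\<close>

lemma conn_Diff_cases:
  assumes "connected_subgraph (insert (edge_of g) S)" "g \<in> H" "h \<in> H"
  shows "conn S h g \<or> conn S h (\<alpha> g)"
  using conn_insert[OF assms(2) connected_subgraph_conn[OF assms(1,3,2)]] by blast

text \<open>\<open>S\<close> has at most two components, those of the ends of \<open>g\<close>; an
  edge whose ends are separated in \<open>S\<close> must join them.\<close>

lemma connected_subgraph_insert:
  assumes "connected_subgraph (insert (edge_of g) S)" "g \<in> H" "c \<in> H" "\<not> conn S c (\<alpha> c)"
  shows "connected_subgraph (insert (edge_of c) S)"
proof -
  let ?S = "insert (edge_of c) S"
  have c: "conn ?S c (\<alpha> c)" using assms(3) by (simp add: conn_alpha)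
  have up: "conn S x y \<Longrightarrow> conn ?S x y" for x y using conn_mono by blast
  note cases = conn_Diff_cases[OF assms(1,2)]
  have "conn ?S g (\<alpha> g)"
    using cases[OF assms(3)] cases[OF alpha_in_H[OF assms(3)]] assms(4) c up
    by (meson conn_sym conn_trans)
  then have "conn ?S h g" if "h \<in> H" for h
    using cases[OF that] up by (meson conn_sym conn_trans)
  then show ?thesis unfolding connected_subgraph_iff by (meson conn_sym conn_trans)
qed

lemma spanning_tree_exchange:
  assumes T: "spanning_tree T" and f: "f \<in> T" and e: "e \<in> edges"
    and conn: "connected_subgraph (insert e (T - {f}))"
  shows "spanning_tree (insert e (T - {f}))"
proof -
  have sub: "T \<subseteq> edges" and conT: "connected_subgraph T"
    and minT: "\<And>e. e \<in> T \<Longrightarrow> \<not> connected_subgraph (T - {e})"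
    using T by (auto simp: spanning_tree_iff_minimal)
  have "\<not> connected_subgraph (insert e (T - {f}) - {g})" if g: "g \<in> insert e (T - {f})" for g
  proof
    assume *: "connected_subgraph (insert e (T - {f}) - {g})"
    have e': "e \<notin> T - {f}" using conn minT[OF f] by (metis insert_absorb)
    show False
    proof (cases "g = e")
      case True
      then show False using * e' minT[OF f] by simp
    next
      case False
      let ?U = "T - {f, g}"
      have g': "g \<in> T" "g \<noteq> f" using g False by auto
      obtain c where c: "c \<in> H" "e = edge_of c" using e edgesE by blast
      obtain a where a: "a \<in> H" "f = edge_of a" using f sub edgesE by blast
      have U: "connected_subgraph (insert (edge_of c) ?U)"
        by (rule connected_subgraph_mono[OF *]) (use c in auto)
      \<comment> \<open>The ends of \<open>f\<close> are separated in \<open>T - {f}\<close>, hence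
        also in the smaller set \<open>?U\<close>.\<close>
      have "\<not> conn ?U a (\<alpha> a)"
      proof
        assume "conn ?U a (\<alpha> a)"
        then have "conn (T - {edge_of a}) a (\<alpha> a)" by (rule conn_mono) (use a in auto)
        then show False using connected_subgraph_Diff[OF conT a(1)] minT[OF f] a by simp
      qed
      from connected_subgraph_insert[OF U c(1) a(1) this]
      have "connected_subgraph (T - {g})"
        by (rule connected_subgraph_mono) (use a f g' in auto)
      then show False using minT g' by blast
    qed
  qed
  then show ?thesis using conn sub e by (auto simp: spanning_tree_iff_minimal)
qed

text \<open>A connected \<open>W - {f}\<close> contains an edge between the two components of
  \<open>T - {f}\<close>. Later \<open>W\<close> omits the external edges already met, so that the
  edge found is not met yet.\<close>

lemma cocycle_exchange:
  assumes T: "spanning_tree T" and f: "f \<in> T"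
    and W: "W \<subseteq> edges" "connected_subgraph (W - {f})"
  shows "\<exists>e\<in>W - T. spanning_tree (insert e (T - {f}))"
proof -
  have sub: "T \<subseteq> edges" and conT: "connected_subgraph T"
    and minT: "\<not> connected_subgraph (T - {f})"
    using T f by (auto simp: spanning_tree_iff_minimal)
  obtain a where a: "a \<in> H" "f = edge_of a" using f sub edgesE by blast
  let ?S = "T - {f}"
  have na: "\<not> conn ?S a (\<alpha> a)" using connected_subgraph_Diff[OF conT a(1)] minT a by blast
  have "\<exists>c\<in>H. edge_of c \<in> W - {f} \<and> \<not> conn ?S c (\<alpha> c)"
  proof (rule ccontr)
    assume *: "\<not> ?thesis"
    \<comment> \<open>If no edge of \<open>W - {f}\<close> crossed, the component of
      \<open>a\<close> in \<open>?S\<close> would be closed along \<open>W - {f}\<close>.\<close>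
    have "\<alpha> a \<in> {x. conn ?S a x}"
    proof (rule conn_closed[OF connected_subgraph_conn[OF W(2) a(1) alpha_in_H[OF a(1)]]])
      fix x assume "x \<in> {x. conn ?S a x}" "x \<in> H" "edge_of x \<in> W - {f}"
      then show "\<alpha> x \<in> {x. conn ?S a x}" using * conn_trans by blast
    qed (use conn_refl conn_sigma conn_trans in auto)
    then show False using na by simp
  qed
  then obtain c where c: "c \<in> H" "edge_of c \<in> W - {f}" "\<not> conn ?S c (\<alpha> c)" by blast
  have "connected_subgraph (insert (edge_of a) ?S)"
    using conT f a(2) by (simp add: insert_absorb)
  from connected_subgraph_insert[OF this a(1) c(1,3)]
  have "spanning_tree (insert (edge_of c) ?S)"
    using spanning_tree_exchange[OF T f edge_in_edges[OF c(1)]] by blast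
  moreover have "edge_of c \<notin> T" using c(2,3) conn_alpha[OF c(1), of ?S] by auto
  ultimately show ?thesis using c(2) by blast
qed

text \<open>In a forest the path from \<open>c\<close> to \<open>d\<close> is unique; edges that do
  not separate \<open>c\<close> from \<open>d\<close> one at a time lie off it and can be deleted
  together.\<close>

lemma forest_conn_Diff:
  assumes F: "forest F" "F \<subseteq> edges" and D: "finite D" "D \<subseteq> F" and "conn F c d"
    and "\<And>f. f \<in> D \<Longrightarrow> conn (F - {f}) c d"
  shows "conn (F - D) c d"
  using D assms(6)
proof induction
  case empty
  then show ?case using assms(5) by simp
next
  case (insert f D)
  have f: "f \<in> F" "f \<notin> D" using insert by auto
  obtain a where a: "a \<in> H" "f = edge_of a" using F(2) f(1) edgesE by blast
  let ?S = "F - insert f D"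
  have up: "conn (F - {f}) x y" if "conn ?S x y" for x y
    by (rule conn_mono[OF that]) auto
  have no: "\<not> conn (F - {f}) a (\<alpha> a)" using forestD[OF F(1) a(1)] a f by simp
  have cd: "conn (F - {f}) c d" using insert.prems by simp
  have "conn (F - D) c d" using insert by simp
  moreover have "insert (edge_of a) ?S = F - D" using a f by auto
  ultimately have "conn (insert (edge_of a) ?S) c d" by simp
  \<comment> \<open>A path through \<open>f\<close>, combined with a connection of \<open>c\<close>
    and \<open>d\<close> that avoids \<open>f\<close>, would join the ends of \<open>f\<close> in
    \<open>F - {f}\<close>.\<close>
  from conn_insert[OF a(1) this] consider "conn ?S c d"
    | "conn (F - {f}) c a" "conn (F - {f}) (\<alpha> a) d" | "conn (F - {f}) c (\<alpha> a)" "conn (F - {f}) a d"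
    using up by blast
  then show ?case
  proof cases
    case 2
    then show ?thesis using cd no conn_trans conn_sym by metis
  next
    case 3
    then show ?thesis using cd no conn_trans conn_sym by metis
  qed
qed

text \<open>The path in \<open>T\<close> between the ends of \<open>c\<close> leaves
  \<open>I\<close>, and an edge \<open>f\<close> on it outside \<open>I\<close> can be replaced.
  Later \<open>I\<close> consists of the internal edges already met.\<close>

lemma cycle_exchange:
  assumes T: "spanning_tree T" and c: "c \<in> H" and I: "I \<subseteq> T" "\<not> conn I c (\<alpha> c)"
  shows "\<exists>f\<in>T - I. spanning_tree (insert (edge_of c) (T - {f}))"
proof -
  have sub: "T \<subseteq> edges" and conT: "connected_subgraph T" and F: "forest T"
    using T by (auto simp: spanning_tree_iff)
  have "\<exists>f\<in>T - I. \<not> conn (T - {f}) c (\<alpha> c)"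
  proof (rule ccontr)
    assume no: "\<not> ?thesis"
    have "conn (T - (T - I)) c (\<alpha> c)"
    proof (rule forest_conn_Diff[OF F sub])
      show "finite (T - I)" using finite_subset[OF sub finite_edges] by simp
      show "conn T c (\<alpha> c)" using connected_subgraph_conn[OF conT c alpha_in_H[OF c]] .
    qed (use no in auto)
    moreover have "T - (T - I) = I" using I(1) by blast
    ultimately show False using I(2) by simp
  qed
  then obtain f where f: "f \<in> T - I" "\<not> conn (T - {f}) c (\<alpha> c)" by blast
  obtain a where a: "a \<in> H" "f = edge_of a" using f sub edgesE by blast
  have "connected_subgraph (insert (edge_of a) (T - {f}))"
    using conT f a(2) by (simp add: insert_absorb)
  from connected_subgraph_insert[OF this a(1) c f(2)]
  show ?thesis using spanning_tree_exchange[OF T _ edge_in_edges[OF c]] f(1) by blast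
qed

section \<open>The tour of a spanning tree\<close>

lemma alpha_not_in_H: "h \<notin> H \<Longrightarrow> \<alpha> h = h"
  using alpha_permutes by (simp add: permutes_not_in)

lemma motion_permutes: "motion F permutes H"
proof -
  define \<beta> where "\<beta> h = (if edge_of h \<in> F then \<alpha> h else h)" for h
  have edge: "edge_of (\<alpha> h) = edge_of h" for h
    using edge_of_alpha alpha_not_in_H by (cases "h \<in> H") auto
  have "\<alpha> (\<alpha> h) = h" for h
    using alpha_involution alpha_not_in_H by (cases "h \<in> H") auto
  then have "\<beta> (\<beta> h) = h" for h by (simp add: \<beta>_def edge)
  moreover have "\<beta> h = h" if "h \<notin> H" for h using that by (simp add: \<beta>_def alpha_not_in_H)
  ultimately have "\<beta> permutes H" unfolding permutes_def by metis
  from permutes_compose[OF this sigma_permutes] have "\<sigma> \<circ> \<beta> permutes H" .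
  moreover have "\<sigma> \<circ> \<beta> = motion F" by (auto simp: motion_def \<beta>_def)
  ultimately show ?thesis by simp
qed

lemma motion_in_H: "h \<in> H \<Longrightarrow> motion F h \<in> H"
  using permutes_in_image[OF motion_permutes] by blast

lemma conn_motion: "h \<in> H \<Longrightarrow> conn F h (motion F h)"
  unfolding motion_def using conn_alpha conn_sigma conn_trans by (metis (full_types))

text \<open>Adding an edge \<open>{a, \<alpha> a}\<close> to a forest composes the motion function with the transposition of
  \<open>a\<close> and \<open>\<alpha> a\<close>, which lie in different cycles because they lie in different components; this
  merges the two cycles.\<close>

lemma forest_motion_closed:
  assumes "finite F" "forest F" "F \<subseteq> edges" "Q \<subseteq> H" "\<And>x. x \<in> Q \<Longrightarrow> motion F x \<in> Q"
  shows "(\<forall>x\<in>Q. \<sigma> x \<in> Q) \<and> (\<forall>x\<in>Q. edge_of x \<in> F \<longrightarrow> \<alpha> x \<in> Q)"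
  using assms
proof (induction F)
  case empty
  then show ?case by (simp add: motion_def)
next
  case (insert f F)
  obtain a where a: "a \<in> H" "f = edge_of a" using insert.prems(2) edgesE by blast
  have F: "insert f F - {f} = F" using insert.hyps by auto
  have other: "motion (insert f F) x = motion F x" if "edge_of x \<noteq> f" for x
    using that by (simp add: motion_def)
  have cross: "motion F (\<alpha> x) = motion (insert f F) x" if "x \<in> H" "edge_of x = f" for x
    using that insert.hyps edge_of_alpha[OF that(1)] by (simp add: motion_def)
  \<comment> \<open>Follow the orbit of \<open>\<alpha> b\<close> under \<open>motion F\<close>. It
    stays in the component of \<open>\<alpha> b\<close> and never meets \<open>b\<close>, so it
    differs from the larger motion only at \<open>\<alpha> b\<close>; its first step is the step of
    the larger motion out of \<open>b\<close>. Hence it lies in \<open>Q\<close>, and it returns to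
    \<open>\<alpha> b\<close>.\<close>
  have swap: "\<alpha> b \<in> Q" if b: "b \<in> Q" "edge_of b = f" for b
  proof -
    have bH: "b \<in> H" "\<alpha> b \<in> H" using b insert.prems(3) alpha_in_H by auto
    have nc: "\<not> conn F b (\<alpha> b)" using forestD[OF insert.prems(1) bH(1)] b(2) F by simp
    have start: "motion F (\<alpha> b) \<in> Q" using cross[OF bH(1) b(2)] insert.prems(4) b(1) by simp
    have "y \<in> Q \<and> conn F (\<alpha> b) y" if "y \<in> orbit (motion F) (\<alpha> b)" for y
      using that
    proof induction
      case base
      then show ?case using start conn_motion bH(2) by blast
    next
      case (step y)
      then have yH: "y \<in> H" using insert.prems(3) by blast
      have "y \<noteq> b" using step.IH nc conn_sym by blast
      have "motion F y \<in> Q"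
      proof (cases "edge_of y = f")
        case True
        then have "y = \<alpha> b" using \<open>y \<noteq> b\<close> b(2) edge_of_eq_iff[OF bH(1)] by simp
        then show ?thesis using start by simp
      next
        case False
        then show ?thesis using other[OF False] insert.prems(4) step.IH by metis
      qed
      then show ?case using step.IH conn_motion[OF yH] conn_trans by blast
    qed
    moreover have "\<alpha> b \<in> orbit (motion F) (\<alpha> b)"
      using motion_permutes finite_H
      by (intro permutation_self_in_orbit) (auto simp: permutation_permutes)
    ultimately show ?thesis by blast
  qed
  \<comment> \<open>By \<open>swap\<close>, closure under the larger motion passes to
    \<open>motion F\<close>, as the induction hypothesis requires.\<close>
  have "motion F x \<in> Q" if x: "x \<in> Q" for x
  proof (cases "edge_of x = f")
    case True
    have xH: "x \<in> H" using x insert.prems(3) by blast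
    have "motion F (\<alpha> (\<alpha> x)) = motion (insert f F) (\<alpha> x)"
      by (rule cross) (use xH True edge_of_alpha alpha_in_H in auto)
    then show ?thesis using alpha_involution[OF xH] insert.prems(4)[OF swap[OF x True]] by simp
  next
    case False
    then show ?thesis using other[OF False] insert.prems(4)[OF x] by simp
  qed
  moreover have "forest F" using forest_subset[OF insert.prems(1)] by blast
  ultimately have "(\<forall>x\<in>Q. \<sigma> x \<in> Q) \<and> (\<forall>x\<in>Q. edge_of x \<in> F \<longrightarrow> \<alpha> x \<in> Q)"
    using insert.IH insert.prems by simp
  then show ?case using swap by auto
qed

text \<open>An orbit is closed under \<sigma> and, across \<open>T\<close>, under \<alpha>; as
  \<open>T\<close> is connected, the motion is a single cycle.\<close>

lemma motion_orbit:
  assumes T: "spanning_tree T" and h: "h \<in> H"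
  shows "orbit (motion T) h = H"
proof -
  let ?Q = "orbit (motion T) h"
  have sub: "?Q \<subseteq> H" using permutes_orbit_subset[OF motion_permutes h] .
  have T': "T \<subseteq> edges" "connected_subgraph T" "forest T" using T by (auto simp: spanning_tree_iff)
  have closed: "(\<forall>x\<in>?Q. \<sigma> x \<in> ?Q) \<and> (\<forall>x\<in>?Q. edge_of x \<in> T \<longrightarrow> \<alpha> x \<in> ?Q)"
    using T' sub finite_subset[OF T'(1) finite_edges]
    by (intro forest_motion_closed) (auto intro: orbit.step)
  have h': "h \<in> ?Q"
    using motion_permutes finite_H
    by (intro permutation_self_in_orbit) (auto simp: permutation_permutes)
  have "x \<in> ?Q" if "x \<in> H" for x
    by (rule conn_closed[OF connected_subgraph_conn[OF T'(2) h that] h']) (use closed in auto)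
  then show ?thesis using sub by blast
qed

lemma tour_bij:
  assumes T: "spanning_tree T"
  shows "bij_betw (\<lambda>n. (motion T ^^ n) h\<^sub>0) {..<card H} H"
    and "(motion T ^^ card H) h\<^sub>0 = h\<^sub>0"
proof -
  let ?t = "motion T"
  let ?M = "funpow_dist1 ?t h\<^sub>0 h\<^sub>0"
  have orb: "orbit ?t h\<^sub>0 = H" using motion_orbit[OF T root_in_H] .
  have self: "h\<^sub>0 \<in> orbit ?t h\<^sub>0" using orb root_in_H by simp
  have bij: "bij_betw (\<lambda>n. (?t ^^ n) h\<^sub>0) {0..<?M} H"
    unfolding bij_betw_def using inj_on_funpow_dist1[OF self] orbit_conv_funpow_dist1[OF self] orb
    by simp
  then have M: "?M = card H" using bij_betw_same_card by fastforce
  show "bij_betw (\<lambda>n. (?t ^^ n) h\<^sub>0) {..<card H} H"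
    using bij unfolding M by (simp add: atLeast0LessThan)
  show "(?t ^^ card H) h\<^sub>0 = h\<^sub>0" using funpow_dist1_prop[OF self] unfolding M .
qed

section \<open>Positions of edges on the tour\<close>

lemma position_eq:
  assumes "spanning_tree T" "n < card H"
  shows "position T ((motion T ^^ n) h\<^sub>0) = n"
proof -
  have "inj_on (\<lambda>n. (motion T ^^ n) h\<^sub>0) {..<card H}"
    using tour_bij(1)[OF assms(1)] by (simp add: bij_betw_def)
  then show ?thesis
    unfolding position_def using assms(2)
    by (intro Least_equality) (auto simp: inj_on_def not_less[symmetric])
qed

lemma position_props:
  assumes "spanning_tree T" "h \<in> H"
  shows "position T h < card H" "(motion T ^^ position T h) h\<^sub>0 = h"
proof -
  obtain n where n: "n < card H" "h = (motion T ^^ n) h\<^sub>0"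
    using tour_bij(1)[OF assms(1)] assms(2) unfolding bij_betw_def by auto
  then show "position T h < card H" "(motion T ^^ position T h) h\<^sub>0 = h"
    using position_eq[OF assms(1) n(1)] by simp_all
qed

lemma position_inject:
  "spanning_tree T \<Longrightarrow> h \<in> H \<Longrightarrow> h' \<in> H \<Longrightarrow> position T h = position T h' \<longleftrightarrow> h = h'"
  using position_props(2) by metis

definition last_position :: "'h set set \<Rightarrow> 'h set \<Rightarrow> nat" where
  "last_position T e = Max (position T ` e)"

lemma last_position_edge: "last_position T (edge_of h) = max (position T h) (position T (\<alpha> h))"
  by (simp add: last_position_def edge_of_def)

lemma edge_less_edge:
  "edge_less T (edge_of h) (edge_of h') \<longleftrightarrow>
     min (position T h) (position T (\<alpha> h)) < min (position T h') (position T (\<alpha> h'))"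
  by (simp add: edge_less_def edge_of_def)

text \<open>Removing a tree edge cuts the tour into two arcs, one for each component. An external edge
  joining the two components therefore has one half-edge on each arc.\<close>

lemma exchange_positions_cross:
  assumes T: "spanning_tree T" and a: "a \<in> H" "edge_of a \<in> T" and c: "c \<in> H" "edge_of c \<notin> T"
    and tree: "spanning_tree (insert (edge_of c) (T - {edge_of a}))"
    and less: "position T a < position T (\<alpha> a)"
  shows "(position T a < position T c \<and> position T c < position T (\<alpha> a)) \<noteq>
         (position T a < position T (\<alpha> c) \<and> position T (\<alpha> c) < position T (\<alpha> a))"
proof -
  let ?S = "T - {edge_of a}" and ?p = "position T" and ?x = "\<lambda>n. (motion T ^^ n) h\<^sub>0"
  have aH: "\<alpha> a \<in> H" using a alpha_in_H by blast
  have xH: "?x n \<in> H" for n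
    by (induction n) (use root_in_H motion_in_H in auto)
  have cH: "\<alpha> c \<in> H" using c alpha_in_H by blast
  have "insert (edge_of c) ?S - {edge_of c} = ?S" using c(2) by auto
  then have nc: "\<not> conn ?S c (\<alpha> c)"
    using tree forestD[of "insert (edge_of c) ?S" c] c(1) by (simp add: spanning_tree_iff)
  have conn_step: "conn ?S (?x n) (?x (Suc n))" if n: "n < card H" "n \<noteq> ?p a" "n \<noteq> ?p (\<alpha> a)" for n
  proof -
    have "?x n \<noteq> a" "?x n \<noteq> \<alpha> a" using position_eq[OF T n(1)] n by auto
    then have "edge_of (?x n) \<noteq> edge_of a" using edge_of_eq_iff[OF a(1)] by simp
    then have "motion ?S (?x n) = motion T (?x n)" by (simp add: motion_def)
    then show ?thesis using conn_motion[OF xH, of ?S n] by simp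
  qed
  \<comment> \<open>Position \<open>j\<close> itself may belong to the removed edge: only steps out
    of earlier positions are taken.\<close>
  have arc: "conn ?S (?x i) (?x j)"
    if "i \<le> j" "j \<le> card H" "\<And>n. i \<le> n \<Longrightarrow> n < j \<Longrightarrow> n \<noteq> ?p a \<and> n \<noteq> ?p (\<alpha> a)" for i j
    using that
  proof (induction j rule: dec_induct)
    case base
    show ?case by (rule conn_refl)
  next
    case (step n)
    have "conn ?S (?x i) (?x n)" using step by simp
    moreover have "conn ?S (?x n) (?x (Suc n))"
      using conn_step[of n] step.hyps step.prems by simp
    ultimately show ?case by (rule conn_trans)
  qed
  have pa: "?x (?p a) = a" "?p a < card H" "?x (?p (\<alpha> a)) = \<alpha> a" "?p (\<alpha> a) < card H"
    using position_props[OF T a(1)] position_props[OF T aH] by auto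
  have inside: "conn ?S h (\<alpha> a)" if h: "h \<in> H" "?p a < ?p h" "?p h < ?p (\<alpha> a)" for h
    using arc[of "?p h" "?p (\<alpha> a)"] h pa position_props[OF T h(1)] by simp
  \<comment> \<open>This arc passes through the root: it runs up to position \<open>card H\<close>,
    where the tour is back at \<open>h\<^sub>0\<close>, and then from 0 to \<open>a\<close>.\<close>
  have outside: "conn ?S h a" if h: "h \<in> H" "\<not> (?p a < ?p h \<and> ?p h < ?p (\<alpha> a))" "h \<noteq> \<alpha> a" for h
  proof (cases "?p h \<le> ?p a")
    case True
    then show ?thesis using arc[of "?p h" "?p a"] less pa position_props[OF T h(1)] by simp
  next
    case False
    then have "?p (\<alpha> a) < ?p h"
      using h(2,3) position_inject[OF T h(1) aH] by linarith
    then have "conn ?S h (?x (card H))"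
      using arc[of "?p h" "card H"] less pa position_props[OF T h(1)] by simp
    moreover have "conn ?S (?x 0) a" using arc[of 0 "?p a"] less pa by simp
    ultimately show ?thesis using tour_bij(2)[OF T] conn_trans by simp
  qed
  have "c \<noteq> \<alpha> a" "\<alpha> c \<noteq> \<alpha> a" using a c edge_of_alpha by metis+
  then have "conn ?S c x \<Longrightarrow> \<not> conn ?S (\<alpha> c) x" for x
    using nc conn_sym conn_trans by blast
  then show ?thesis
    using inside[OF c(1)] inside[OF cH] outside[OF c(1)] outside[OF cH] \<open>c \<noteq> \<alpha> a\<close> \<open>\<alpha> c \<noteq> \<alpha> a\<close>
    by blast
qed

text \<open>Exactly one half-edge of \<open>e\<close> lies between those of \<open>f\<close>;
  whichever edge starts first therefore also ends first.\<close>

lemma exchange_order: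
  assumes T: "spanning_tree T" and f: "f \<in> T" and e: "e \<in> edges" "e \<notin> T"
    and tree: "spanning_tree (insert e (T - {f}))"
  shows "edge_less T e f \<longleftrightarrow> last_position T e < last_position T f"
    and "edge_less T f e \<longleftrightarrow> last_position T f < last_position T e"
    and "last_position T e \<noteq> last_position T f"
proof -
  let ?p = "position T"
  have "f \<in> edges" using T f by (auto simp: spanning_tree_def)
  then obtain b where b: "b \<in> H" "f = edge_of b" using edgesE by blast
  have "?p b \<noteq> ?p (\<alpha> b)"
    using position_inject[OF T b(1) alpha_in_H] b alpha_no_fixpoint by metis
  then have "\<exists>a\<in>H. f = edge_of a \<and> ?p a < ?p (\<alpha> a)"
    using b edge_of_alpha[OF b(1)] alpha_in_H[OF b(1)] alpha_involution[OF b(1)]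
    by (metis nat_neq_iff)
  then obtain a where a: "a \<in> H" "f = edge_of a" "?p a < ?p (\<alpha> a)" by blast
  obtain c where c: "c \<in> H" "e = edge_of c" using e edgesE by blast
  have ne: "?p x \<noteq> ?p y" if "x \<in> {a, \<alpha> a}" "y \<in> {c, \<alpha> c}" for x y
  proof -
    have "x \<in> H" "y \<in> H" "edge_of x = f" "edge_of y = e"
      using that a c alpha_in_H edge_of_alpha by auto
    then show ?thesis using position_inject[OF T] f e by metis
  qed
  have ne': "?p a \<noteq> ?p c" "?p a \<noteq> ?p (\<alpha> c)" "?p (\<alpha> a) \<noteq> ?p c" "?p (\<alpha> a) \<noteq> ?p (\<alpha> c)"
    using ne by simp_all
  have cross: "(?p a < ?p c \<and> ?p c < ?p (\<alpha> a)) \<noteq> (?p a < ?p (\<alpha> c) \<and> ?p (\<alpha> c) < ?p (\<alpha> a))"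
    using exchange_positions_cross[OF T a(1) _ c(1)] f e tree a c by simp
  show "edge_less T e f \<longleftrightarrow> last_position T e < last_position T f"
    and "edge_less T f e \<longleftrightarrow> last_position T f < last_position T e"
    and "last_position T e \<noteq> last_position T f"
    unfolding a(2) c(2) edge_less_edge last_position_edge using cross ne' a(3)
    by linarith+
qed

section \<open>The reverse tour\<close>

text \<open>The inverse of the motion function on \<open>H\<close>. The type tested is that of the
  edge being entered.\<close>

definition retreat :: "'h set set \<Rightarrow> 'h \<Rightarrow> 'h" where
  "retreat T h = (let g = inv_into UNIV \<sigma> h in if edge_of g \<in> T then \<alpha> g else g)"

definition reverse_tour :: "'h set set \<Rightarrow> nat \<Rightarrow> 'h" where
  "reverse_tour T n = (retreat T ^^ n) h\<^sub>0"

text \<open>Counting begins at 1: as the first half-edge of the tour, the root is met last on the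
  way back, at step \<open>card H\<close>.\<close>

definition visited :: "'h set set \<Rightarrow> nat \<Rightarrow> 'h set set" where
  "visited T n = (\<lambda>k. edge_of (reverse_tour T k)) ` {1..n}"

lemma inv_sigma_in_H: "h \<in> H \<Longrightarrow> inv_into UNIV \<sigma> h \<in> H"
  using permutes_in_image[OF permutes_inv[OF sigma_permutes]] by blast

lemma retreat_in_H: "h \<in> H \<Longrightarrow> retreat T h \<in> H"
  using inv_sigma_in_H alpha_in_H by (simp add: retreat_def Let_def)

text \<open>The right-hand side is free of \<open>T\<close>: which edge is met next is fixed before
  its own type matters.\<close>

lemma edge_of_retreat: "h \<in> H \<Longrightarrow> edge_of (retreat T h) = edge_of (inv_into UNIV \<sigma> h)"
  using inv_sigma_in_H edge_of_alpha by (simp add: retreat_def Let_def)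

lemma retreat_motion: "h \<in> H \<Longrightarrow> retreat T (motion T h) = h"
  using permutes_inverses(2)[OF sigma_permutes] edge_of_alpha alpha_involution
  by (simp add: retreat_def motion_def Let_def)

lemma reverse_tour_in_H: "reverse_tour T n \<in> H"
  unfolding reverse_tour_def by (induction n) (use root_in_H retreat_in_H in auto)

lemma reverse_tour_Suc: "reverse_tour T (Suc n) = retreat T (reverse_tour T n)"
  by (simp add: reverse_tour_def)

lemma reverse_tour_eq:
  assumes T: "spanning_tree T" and "n \<le> card H"
  shows "reverse_tour T n = (motion T ^^ (card H - n)) h\<^sub>0"
  using assms(2)
proof (induction n)
  case 0
  then show ?case using tour_bij(2)[OF T] by (simp add: reverse_tour_def)
next
  case (Suc n)
  have H: "(motion T ^^ k) h\<^sub>0 \<in> H" for k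
    by (induction k) (use root_in_H motion_in_H in auto)
  have "card H - n = Suc (card H - Suc n)" using Suc.prems by simp
  then show ?case using Suc retreat_motion[OF H] by (simp add: reverse_tour_Suc)
qed

text \<open>Going back \<open>n\<close> steps covers the last \<open>n\<close> positions, and an
  edge is met as soon as its later half-edge is. The sum avoids truncated subtraction.\<close>

lemma visited_iff:
  assumes T: "spanning_tree T" and n: "n \<le> card H" and e: "e \<in> edges"
  shows "e \<in> visited T n \<longleftrightarrow> card H \<le> last_position T e + n"
proof
  assume "e \<in> visited T n"
  then obtain k where k: "1 \<le> k" "k \<le> n" "e = edge_of (reverse_tour T k)"
    by (auto simp: visited_def)
  have "position T (reverse_tour T k) = card H - k"
    using reverse_tour_eq[OF T, of k] position_eq[OF T, of "card H - k"] k n by simp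
  then show "card H \<le> last_position T e + n"
    using k by (simp add: last_position_edge)
next
  assume *: "card H \<le> last_position T e + n"
  obtain h where h: "h \<in> H" "e = edge_of h" using e edgesE by blast
  then have "\<exists>g\<in>H. e = edge_of g \<and> last_position T e = position T g"
    using edge_of_alpha alpha_in_H by (metis last_position_edge max_def)
  then obtain g where g: "g \<in> H" "e = edge_of g" "last_position T e = position T g" by blast
  let ?k = "card H - position T g"
  have "position T g < card H" using position_props(1)[OF T g(1)] .
  then have "reverse_tour T ?k = g" "?k \<in> {1..n}"
    using reverse_tour_eq[OF T, of ?k] position_props(2)[OF T g(1)] * g(3) by auto
  then show "e \<in> visited T n" using g(2) unfolding visited_def by (metis imageI)
qed

text \<open>Marks the first encounter with \<open>e\<close>, so that \<open>visited T n\<close> is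
  exactly the past on which the activity of \<open>e\<close> will depend.\<close>

definition visited_next :: "'h set set \<Rightarrow> nat \<Rightarrow> 'h set \<Rightarrow> bool" where
  "visited_next T n e \<longleftrightarrow> e = edge_of (reverse_tour T (Suc n)) \<and> e \<notin> visited T n"

lemma visited_next_in_edges: "visited_next T n e \<Longrightarrow> e \<in> edges"
  unfolding visited_next_def using reverse_tour_in_H edge_in_edges by blast

lemma visited_mono: "m \<le> n \<Longrightarrow> visited T m \<subseteq> visited T n"
  unfolding visited_def by (intro image_mono) auto

lemma visited_Suc: "visited T (Suc n) = insert (edge_of (reverse_tour T (Suc n))) (visited T n)"
proof -
  have "{1..Suc n} = insert (Suc n) {1..n}" by auto
  then show ?thesis unfolding visited_def by simp
qed

lemma visited_subset: "visited T n \<subseteq> edges"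
  unfolding visited_def using reverse_tour_in_H edge_in_edges by blast

lemma visited_all:
  assumes "spanning_tree T" shows "visited T (card H) = edges"
  using visited_iff[OF assms order_refl] visited_subset by auto

lemma visited_next_exists:
  assumes "e \<in> visited T n"
  shows "\<exists>k<n. visited_next T k e"
proof -
  let ?k = "LEAST k. e \<in> visited T k"
  have k: "e \<in> visited T ?k" "?k \<le> n" using assms by (auto intro: LeastI Least_le)
  \<comment> \<open>\<open>visited T 0\<close> is empty.\<close>
  have "?k \<noteq> 0" using k(1) by (auto simp: visited_def intro: ccontr)
  then obtain m where m: "?k = Suc m" using not0_implies_Suc by blast
  have "e \<notin> visited T m" using not_less_Least[of m "\<lambda>k. e \<in> visited T k"] m by simp
  then have "visited_next T m e" using k(1) unfolding m visited_Suc visited_next_def by auto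
  moreover have "m < n" using k(2) m by simp
  ultimately show ?thesis by blast
qed

section \<open>Activity in terms of the edges met before\<close>

lemma visited_iff_last_position:
  assumes T: "spanning_tree T" and next_e: "visited_next T n e" and e': "e' \<in> edges"
  shows "e' \<in> visited T n \<longleftrightarrow> last_position T e < last_position T e'"
proof -
  have e: "e \<in> edges" using visited_next_in_edges[OF next_e] .
  have e_n: "e \<notin> visited T n" "e \<in> visited T (Suc n)"
    using next_e by (auto simp: visited_next_def visited_Suc)
  have n: "n < card H"
  proof (rule ccontr)
    assume "\<not> n < card H"
    then show False using visited_mono[of "card H" n T] visited_all[OF T] e e_n by auto
  qed
  \<comment> \<open>Membership of \<open>e\<close> at \<open>Suc n\<close> but not at
    \<open>n\<close> pins its last position to \<open>card H - Suc n\<close>.\<close>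
  show ?thesis
    using visited_iff[OF T _ e, of n] visited_iff[OF T _ e, of "Suc n"] visited_iff[OF T _ e', of n]
      n e_n by auto
qed

text \<open>By \<open>exchange_order\<close>, a smaller edge in the cocycle is an external edge not
  met yet, and such an edge reconnects \<open>T - {e}\<close> inside \<open>?W - {e}\<close>.
  Conversely, if \<open>?W - {e}\<close> is connected, \<open>cocycle_exchange\<close> finds
  one.\<close>

lemma internal_active_iff:
  assumes T: "spanning_tree T" and next_e: "visited_next T n e" and e: "e \<in> T"
  shows "e \<in> internal_active T \<longleftrightarrow> \<not> connected_subgraph (edges - (visited T n - T) - {e})"
    (is "_ \<longleftrightarrow> \<not> connected_subgraph (?W - {e})")
proof
  assume act: "e \<in> internal_active T"
  show "\<not> connected_subgraph (?W - {e})"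
  proof
    assume "connected_subgraph (?W - {e})"
    from cocycle_exchange[OF T e _ this] obtain e' where
      e': "e' \<in> ?W - T" "spanning_tree (insert e' (T - {e}))" by auto
    then have e'': "e' \<in> edges" "e' \<notin> T" "e' \<notin> visited T n" by auto
    have "e' \<in> fundamental_cocycle T e" using e' by (simp add: fundamental_cocycle_def)
    then have "\<not> edge_less T e' e" using act by (simp add: internal_active_def)
    \<comment> \<open>\<open>exchange_order\<close> also excludes ties, so the unvisited
      \<open>e'\<close> is smaller than \<open>e\<close>.\<close>
    then show False
      using exchange_order[OF T e e''(1,2) e'(2)]
        visited_iff_last_position[OF T next_e e''(1)] e''(3) by linarith
  qed
next
  assume disc: "\<not> connected_subgraph (?W - {e})"
  have "\<not> edge_less T e' e" if "e' \<in> fundamental_cocycle T e" for e'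
  proof
    assume less: "edge_less T e' e"
    have e': "e' \<in> edges" "spanning_tree (insert e' (T - {e}))"
      using that by (auto simp: fundamental_cocycle_def)
    have ne: "e' \<noteq> e" using less by (auto simp: edge_less_def)
    have e'T: "e' \<notin> T"
    proof
      assume "e' \<in> T"
      then have "insert e' (T - {e}) = T - {e}" using ne by auto
      then have "connected_subgraph (T - {e})" using e'(2) by (simp add: spanning_tree_def)
      then show False using T e by (auto simp: spanning_tree_iff_minimal)
    qed
    then have "last_position T e' < last_position T e"
      using exchange_order(1)[OF T e e'(1) e'T e'(2)] less by simp
    then have "e' \<notin> visited T n" using visited_iff_last_position[OF T next_e e'(1)] by simp
    then have "insert e' (T - {e}) \<subseteq> ?W - {e}"
      using e'(1) ne T by (auto simp: spanning_tree_def)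
    then show False
      using connected_subgraph_mono e'(2) disc unfolding spanning_tree_def by blast
  qed
  then show "e \<in> internal_active T" using e by (simp add: internal_active_def)
qed

text \<open>Dual argument: if the internal edges met do not join the ends of \<open>e\<close>,
  \<open>cycle_exchange\<close> yields a smaller \<open>f\<close> not met yet. If they do,
  exchanging an unmet \<open>f\<close> keeps them all, and \<open>e\<close> would close a cycle in
  the new tree.\<close>

lemma external_active_iff:
  assumes T: "spanning_tree T" and next_e: "visited_next T n e" and e: "e \<notin> T"
    and c: "c \<in> H" "e = edge_of c"
  shows "e \<in> external_active T \<longleftrightarrow> conn (T \<inter> visited T n) c (\<alpha> c)"
proof
  have eE: "e \<in> edges" using visited_next_in_edges[OF next_e] .
  assume act: "e \<in> external_active T"
  show "conn (T \<inter> visited T n) c (\<alpha> c)"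
  proof (rule ccontr)
    assume "\<not> ?thesis"
    from cycle_exchange[OF T c(1) _ this] obtain f where
      f: "f \<in> T" "f \<notin> visited T n" "spanning_tree (insert e (T - {f}))" using c(2) by auto
    have fE: "f \<in> edges" using f(1) T by (auto simp: spanning_tree_def)
    have "insert e T - {f} = insert e (T - {f})" using e f(1) by auto
    then have "f \<in> fundamental_cycle T e" using f(3) fE by (simp add: fundamental_cycle_def)
    then have "\<not> edge_less T f e" using act by (simp add: external_active_def)
    then show False
      using exchange_order[OF T f(1) eE e f(3)]
        visited_iff_last_position[OF T next_e fE] f(2) by linarith
  qed
next
  have eE: "e \<in> edges" using visited_next_in_edges[OF next_e] .
  assume conn: "conn (T \<inter> visited T n) c (\<alpha> c)"
  have "\<not> edge_less T f e" if "f \<in> fundamental_cycle T e" for f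
  proof
    assume less: "edge_less T f e"
    have f: "f \<in> edges" "spanning_tree (insert e T - {f})"
      using that by (auto simp: fundamental_cycle_def)
    have ne: "f \<noteq> e" using less by (auto simp: edge_less_def)
    have fT: "f \<in> T"
    proof (rule ccontr)
      assume "f \<notin> T"
      then have "insert e T - {f} = insert e T" using ne by auto
      then have "\<not> connected_subgraph (insert e T - {e})"
        using f(2) by (simp add: spanning_tree_iff_minimal)
      moreover have "insert e T - {e} = T" using e by auto
      ultimately show False using T by (simp add: spanning_tree_def)
    qed
    have eq: "insert e T - {f} = insert e (T - {f})" "insert e (T - {f}) - {e} = T - {f}"
      using ne e by auto
    then have tree: "spanning_tree (insert e (T - {f}))" using f(2) by simp
    then have "last_position T f < last_position T e"
      using exchange_order(2)[OF T fT eE e] less by simp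
    then have "f \<notin> visited T n" using visited_iff_last_position[OF T next_e f(1)] by simp
    then have "conn (T - {f}) c (\<alpha> c)" by (intro conn_mono[OF conn]) auto
    then show False using tree forestD[of "insert e (T - {f})" c] c eq(2)
      by (simp add: spanning_tree_iff)
  qed
  then show "e \<in> external_active T" using e eE by (simp add: external_active_def)
qed

lemma reverse_tour_cong:
  assumes "T \<inter> visited T n = T' \<inter> visited T n" "k \<le> n"
  shows "reverse_tour T k = reverse_tour T' k"
  using assms(2)
proof (induction k)
  case 0
  then show ?case by (simp add: reverse_tour_def)
next
  case (Suc k)
  let ?g = "inv_into UNIV \<sigma> (reverse_tour T k)"
  \<comment> \<open>The type needed for this step is that of an edge in \<open>visited T n\<close>,
    where \<open>T\<close> and \<open>T'\<close> agree.\<close>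
  have "edge_of (reverse_tour T (Suc k)) \<in> visited T n"
    using Suc.prems unfolding visited_def by (intro imageI) simp
  then have "edge_of ?g \<in> visited T n"
    by (simp add: reverse_tour_Suc edge_of_retreat reverse_tour_in_H)
  then have "edge_of ?g \<in> T \<longleftrightarrow> edge_of ?g \<in> T'" using assms(1) by blast
  then show ?case using Suc by (simp add: reverse_tour_Suc retreat_def)
qed

lemma visited_cong:
  assumes "T \<inter> visited T n = T' \<inter> visited T n" "k \<le> n"
  shows "visited T k = visited T' k"
  unfolding visited_def using reverse_tour_cong[OF assms(1)] assms(2) by (intro image_cong) auto

text \<open>The case \<open>k = n\<close> reaches one step beyond the agreement: the half-edge met
  may then differ by \<alpha>, but by \<open>edge_of_retreat\<close> its edge does not.\<close>

lemma visited_next_cong: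
  assumes "T \<inter> visited T n = T' \<inter> visited T n" "k \<le> n"
  shows "visited_next T k e \<longleftrightarrow> visited_next T' k e"
  unfolding visited_next_def using reverse_tour_cong[OF assms] visited_cong[OF assms]
  by (simp add: reverse_tour_Suc edge_of_retreat reverse_tour_in_H)

text \<open>Both activity criteria mention only the types of \<open>e\<close> and of the edges met
  before it, which the two trees share.\<close>

lemma active_cong:
  assumes T: "spanning_tree T" and T': "spanning_tree T'"
    and agree: "T \<inter> visited T n = T' \<inter> visited T n" and e: "e \<in> visited T n"
  shows "e \<in> internal_active T \<longleftrightarrow> e \<in> internal_active T'"
    and "e \<in> external_active T \<longleftrightarrow> e \<in> external_active T'"
proof -
  obtain k where k: "k < n" "visited_next T k e" using visited_next_exists[OF e] by blast
  then have k': "visited_next T' k e" using visited_next_cong[OF agree] by simp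
  have vis: "visited T k = visited T' k" using visited_cong[OF agree] k(1) by simp
  have sub: "visited T k \<subseteq> visited T n" using visited_mono k(1) by simp
  have types: "e \<in> T \<longleftrightarrow> e \<in> T'" using agree e by blast
  have diff: "visited T k - T = visited T k - T'" and int: "T \<inter> visited T k = T' \<inter> visited T k"
    using agree sub by blast+
  obtain c where c: "c \<in> H" "e = edge_of c" using visited_next_in_edges[OF k(2)] edgesE by blast
  show "e \<in> internal_active T \<longleftrightarrow> e \<in> internal_active T'"
  proof (cases "e \<in> T")
    case True
    then show ?thesis
      using internal_active_iff[OF T k(2)] internal_active_iff[OF T' k'] types diff vis by simp
  qed (use types in \<open>simp add: internal_active_def\<close>)
  show "e \<in> external_active T \<longleftrightarrow> e \<in> external_active T'"
  proof (cases "e \<in> T")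
    case False
    then show ?thesis
      using external_active_iff[OF T k(2) _ c] external_active_iff[OF T' k' _ c] types int vis
      by simp
  qed (use types in \<open>simp add: external_active_def\<close>)
qed

section \<open>The partition\<close>

text \<open>The removed and added sets are forced to be \<open>T - S\<close> and
  \<open>S - T\<close>.\<close>

lemma tree_interval_iff:
  assumes "spanning_tree T"
  shows "S \<in> tree_interval T \<longleftrightarrow> T - S \<subseteq> internal_active T \<and> S - T \<subseteq> external_active T"
proof
  assume "T - S \<subseteq> internal_active T \<and> S - T \<subseteq> external_active T"
  moreover have "S = (T - (T - S)) \<union> (S - T)" by blast
  ultimately show "S \<in> tree_interval T" unfolding tree_interval_def by blast
qed (auto simp: tree_interval_def internal_active_def external_active_def)

text \<open>If \<open>e\<close> is not in \<open>S\<close>, it is active in \<open>T\<close>, hence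
  an isthmus of a graph in which the connected \<open>T'\<close> avoids it. If \<open>e\<close> is
  in \<open>S\<close>, it is active in \<open>T'\<close>, hence closes a cycle with internal edges
  met before, all of which lie in \<open>T - {e}\<close>.\<close>

lemma tree_interval_first_difference:
  assumes T: "spanning_tree T" "S \<in> tree_interval T"
    and T': "spanning_tree T'" "S \<in> tree_interval T'"
    and agree: "T \<inter> visited T n = T' \<inter> visited T n" and next_e: "visited_next T n e"
  shows "\<not> (e \<in> T \<and> e \<notin> T')"
proof
  assume e: "e \<in> T \<and> e \<notin> T'"
  have vis: "visited T n = visited T' n" using visited_cong[OF agree] by simp
  have next_e': "visited_next T' n e" using visited_next_cong[OF agree] next_e by simp
  obtain c where c: "c \<in> H" "e = edge_of c" using visited_next_in_edges[OF next_e] edgesE by blast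
  show False
  proof (cases "e \<in> S")
    case False
    then have "e \<in> internal_active T" using T tree_interval_iff e by blast
    then have "\<not> connected_subgraph (edges - (visited T n - T) - {e})"
      using internal_active_iff[OF T(1) next_e] e by simp
    moreover have "T' \<subseteq> edges - (visited T n - T) - {e}"
      using T'(1) agree e by (auto simp: spanning_tree_def)
    ultimately show False using connected_subgraph_mono T'(1) unfolding spanning_tree_def by blast
  next
    case True
    then have "e \<in> external_active T'" using T' tree_interval_iff e by blast
    then have "conn (T' \<inter> visited T' n) c (\<alpha> c)"
      using external_active_iff[OF T'(1) next_e' _ c] e by simp
    moreover have "T' \<inter> visited T' n \<subseteq> T - {e}" using agree e vis by blast
    ultimately have "conn (T - {e}) c (\<alpha> c)" by (rule conn_mono)
    then show False using T(1) forestD[of T c] e c by (simp add: spanning_tree_iff)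
  qed
qed

lemma tree_interval_unique:
  assumes T: "spanning_tree T" "S \<in> tree_interval T"
    and T': "spanning_tree T'" "S \<in> tree_interval T'"
  shows "T = T'"
proof -
  have "T \<inter> visited T n = T' \<inter> visited T n" for n
  proof (induction n)
    case 0
    then show ?case by (simp add: visited_def)
  next
    case (Suc n)
    let ?e = "edge_of (reverse_tour T (Suc n))"
    have "?e \<in> T \<longleftrightarrow> ?e \<in> T'"
    proof (cases "?e \<in> visited T n")
      case True
      then show ?thesis using Suc by blast
    next
      case False
      then have next_e: "visited_next T n ?e" by (simp add: visited_next_def)
      then have next_e': "visited_next T' n ?e" using visited_next_cong[OF Suc] by simp
      \<comment> \<open>The first-difference lemma is one-sided and is applied with both orders of
        the trees.\<close>
      have agree: "T' \<inter> visited T' n = T \<inter> visited T' n"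
        using Suc visited_cong[OF Suc, of n] by simp
      show ?thesis
        using tree_interval_first_difference[OF T T' Suc next_e]
          tree_interval_first_difference[OF T' T agree next_e'] by blast
    qed
    then show ?case using Suc unfolding visited_Suc by blast
  qed
  from this[of "card H"] have "T \<inter> edges = T' \<inter> edges" using visited_all[OF T(1)] by simp
  then show ?thesis using T(1) T'(1) by (auto simp: spanning_tree_def)
qed

text \<open>The tree may change with \<open>n\<close>, but each change only touches edges not in
  \<open>visited T n\<close>, so earlier decisions persist.\<close>

lemma tree_interval_prefix_exists:
  "\<exists>T. spanning_tree T \<and>
     (\<forall>e\<in>visited T n. (e \<in> T - S \<longrightarrow> e \<in> internal_active T) \<and> (e \<in> S - T \<longrightarrow> e \<in> external_active T))"
proof (induction n)
  case 0
  then show ?case using spanning_tree_exists by (auto simp: visited_def)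
next
  case (Suc n)
  let ?good = "\<lambda>T e. (e \<in> T - S \<longrightarrow> e \<in> internal_active T) \<and> (e \<in> S - T \<longrightarrow> e \<in> external_active T)"
  obtain T where T: "spanning_tree T" and good: "\<forall>e\<in>visited T n. ?good T e"
    using Suc by blast
  let ?e = "edge_of (reverse_tour T (Suc n))"
  show ?case
  proof (cases "?good T ?e")
    case True
    then show ?thesis using T good unfolding visited_Suc by blast
  next
    case False
    then have "?e \<notin> visited T n" using good by blast
    then have next_e: "visited_next T n ?e" by (simp add: visited_next_def)
    \<comment> \<open>Agreement on the past preserves the activities there and keeps
      \<open>?e\<close> next; once its type matches \<open>S\<close>, nothing is required of
      it.\<close>
    have switch: ?thesis
      if T': "spanning_tree T'" and agree: "T \<inter> visited T n = T' \<inter> visited T n"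
        and e: "?e \<in> T' \<longleftrightarrow> ?e \<in> S" for T'
    proof -
      have vis: "visited T' n = visited T n" using visited_cong[OF agree] by simp
      have "?good T' e" if "e \<in> visited T n" for e
      proof -
        have "e \<in> T \<longleftrightarrow> e \<in> T'" using agree that by blast
        then show ?thesis using good that active_cong[OF T T' agree that] by blast
      qed
      moreover have "edge_of (reverse_tour T' (Suc n)) = ?e"
        using visited_next_cong[OF agree, of n ?e] next_e by (simp add: visited_next_def)
      ultimately have "\<forall>e\<in>visited T' (Suc n). ?good T' e"
        using e unfolding visited_Suc vis by auto
      then show ?thesis using T' by blast
    qed
    consider "?e \<in> T" "?e \<notin> S" "?e \<notin> internal_active T"
      | "?e \<notin> T" "?e \<in> S" "?e \<notin> external_active T"
      using False by blast
    then show ?thesis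
    proof cases
      case 1
      \<comment> \<open>Not being active, \<open>?e\<close> is no isthmus here, so an external edge
        not met yet can replace it.\<close>
      then have "connected_subgraph (edges - (visited T n - T) - {?e})"
        using internal_active_iff[OF T next_e] by simp
      from cocycle_exchange[OF T 1(1) _ this] obtain e' where
        e': "e' \<in> edges - (visited T n - T)" "e' \<notin> T" "spanning_tree (insert e' (T - {?e}))"
        by auto
      show ?thesis
        by (rule switch[OF e'(3)]) (use e'(1,2) 1 \<open>?e \<notin> visited T n\<close> in auto)
    next
      case 2
      let ?c = "reverse_tour T (Suc n)"
      \<comment> \<open>Not being active, \<open>?e\<close> closes no cycle with the internal edges
        met, so it can replace an internal edge not met yet.\<close>
      have "\<not> conn (T \<inter> visited T n) ?c (\<alpha> ?c)"
        using external_active_iff[OF T next_e 2(1) reverse_tour_in_H refl] 2(3) by simp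
      from cycle_exchange[OF T reverse_tour_in_H _ this] obtain f where
        f: "f \<in> T" "f \<notin> visited T n" "spanning_tree (insert ?e (T - {f}))"
        by auto
      show ?thesis
        by (rule switch[OF f(3)]) (use f(1,2) 2 \<open>?e \<notin> visited T n\<close> in auto)
    qed
  qed
qed

lemma tree_interval_exists:
  assumes "S \<subseteq> edges"
  shows "\<exists>T. spanning_tree T \<and> S \<in> tree_interval T"
proof -
  obtain T where T: "spanning_tree T"
    "\<forall>e\<in>visited T (card H). (e \<in> T - S \<longrightarrow> e \<in> internal_active T) \<and> (e \<in> S - T \<longrightarrow> e \<in> external_active T)"
    using tree_interval_prefix_exists[where n = "card H" and S = S] by metis
  have "T \<subseteq> edges" using T(1) by (simp add: spanning_tree_def)
  then have "S \<in> tree_interval T"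
    using assms T(2) unfolding visited_all[OF T(1)] tree_interval_iff[OF T(1)] by blast
  then show ?thesis using T(1) by blast
qed

lemma tree_interval_subset: "spanning_tree T \<Longrightarrow> tree_interval T \<subseteq> Pow edges"
  by (auto simp: tree_interval_def spanning_tree_def external_active_def)

end

theorem theorem13:
  fixes H :: "'h set" and \<sigma> \<alpha> :: "'h \<Rightarrow> 'h" and h\<^sub>0 :: 'h
  assumes "rooted_map H \<sigma> \<alpha> h\<^sub>0"
  shows "disjoint_family_on (rooted_map.tree_interval H \<sigma> \<alpha> h\<^sub>0)
           {T. rooted_map.spanning_tree H \<sigma> \<alpha> T} \<and>
         (\<Union>T\<in>{T. rooted_map.spanning_tree H \<sigma> \<alpha> T}. rooted_map.tree_interval H \<sigma> \<alpha> h\<^sub>0 T)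
           = Pow (rooted_map.edges H \<alpha>)"
proof -
  interpret rooted_map H \<sigma> \<alpha> h\<^sub>0 by fact
  show ?thesis
  proof
    show "disjoint_family_on tree_interval {T. spanning_tree T}"
      unfolding disjoint_family_on_def using tree_interval_unique by blast
    show "(\<Union>T\<in>{T. spanning_tree T}. tree_interval T) = Pow edges"
    proof
      show "(\<Union>T\<in>{T. spanning_tree T}. tree_interval T) \<subseteq> Pow edges"
        using tree_interval_subset by (intro UN_least) simp
      show "Pow edges \<subseteq> (\<Union>T\<in>{T. spanning_tree T}. tree_interval T)"
        using tree_interval_exists by (intro subsetI) (simp add: Pow_iff)
    qed
  qed
qed

end
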